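(* Let $\alpha,\beta,A>0$ be real numbers and consider the second-order rational difference equation $$x_{n+1}=\frac{\alpha+\beta x_{n}+x_{n-1}}{A+x_{n-1}},\quad n=0,1,\dots,$$ with nonnegative real initial conditions $x_{-1},x_{0}\ge 0$. Then the unique (nonnegative) equilibrium $\bar{x}$ of this difference equation is globally asymptotically stable.
   Context: An equilibrium of the difference equation is a number $\bar{x}\in[0,\infty)$ with $\bar{x}=\frac{\alpha+\beta\bar{x}+\bar{x}}{A+\bar{x}}$; for positive $\alpha,\beta,A$ there is exactly one such number. All solutions considered have nonnegative initial conditions. The equilibrium $\bar{x}$ is locally stable if for every $\varepsilon>0$ there is $\delta>0$ such that every solution with nonnegative initial conditions satisfying $|x_{-1}-\bar{x}|+|x_{0}-\bar{x}|<\delta$ satisfies $|x_n-\bar{x}|<\varepsilon$ for all $n\ge -1$. It is globally asymptotically stable if it is locally stable and every solution with nonnegative initial conditions converges to $\bar{x}$. *)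

theory Defs
  imports Complex_Main
begin

definition rhs :: "real \<Rightarrow> real \<Rightarrow> real \<Rightarrow> real \<Rightarrow> real \<Rightarrow> real" where
  "rhs \<alpha> \<beta> A u v = (\<alpha> + \<beta> * u + v) / (A + v)"

text \<open>Sequences are indexed with a shift by one: the value \<open>x n\<close> stands for the
  mathematical \<open>x\<^sub>n\<^sub>-\<^sub>1\<close>, so \<open>x 0\<close> and \<open>x 1\<close> are the two initial conditions.\<close>

definition nonneg_solution :: "real \<Rightarrow> real \<Rightarrow> real \<Rightarrow> (nat \<Rightarrow> real) \<Rightarrow> bool" where
  "nonneg_solution \<alpha> \<beta> A x \<longleftrightarrow>
     x 0 \<ge> 0 \<and> x 1 \<ge> 0 \<and> (\<forall>n. x (n + 2) = rhs \<alpha> \<beta> A (x (n + 1)) (x n))"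

definition equilibrium :: "real \<Rightarrow> real \<Rightarrow> real \<Rightarrow> real \<Rightarrow> bool" where
  "equilibrium \<alpha> \<beta> A xbar \<longleftrightarrow> xbar \<ge> 0 \<and> xbar = rhs \<alpha> \<beta> A xbar xbar"

definition locally_stable :: "real \<Rightarrow> real \<Rightarrow> real \<Rightarrow> real \<Rightarrow> bool" where
  "locally_stable \<alpha> \<beta> A xbar \<longleftrightarrow>
     (\<forall>\<epsilon>>0. \<exists>\<delta>>0. \<forall>x. nonneg_solution \<alpha> \<beta> A x \<longrightarrow>
        \<bar>x 0 - xbar\<bar> + \<bar>x 1 - xbar\<bar> < \<delta> \<longrightarrow> (\<forall>n. \<bar>x n - xbar\<bar> < \<epsilon>))"

definition globally_asymptotically_stable :: "real \<Rightarrow> real \<Rightarrow> real \<Rightarrow> real \<Rightarrow> bool" where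
  "globally_asymptotically_stable \<alpha> \<beta> A xbar \<longleftrightarrow>
     locally_stable \<alpha> \<beta> A xbar \<and>
     (\<forall>x. nonneg_solution \<alpha> \<beta> A x \<longrightarrow> x \<longlonglongrightarrow> xbar)"

end

theory Submission imports Defs "HOL-Analysis.Elementary_Normed_Spaces" begin

text \<open>
  Let \<open>p\<close> be the equilibrium. Measured by the relative deviation \<open>e = (x - p) / (A + p)\<close>, the
  equation becomes \<open>e\<^sub>n\<^sub>+\<^sub>1 (1 + e\<^sub>n\<^sub>-\<^sub>1) = k e\<^sub>n - g e\<^sub>n\<^sub>-\<^sub>1\<close> with \<open>k = \<beta> / (A + p)\<close> and
  \<open>g = (p - 1) / (A + p)\<close>. Nonnegativity of \<open>x\<close> says \<open>e \<ge> m - 1\<close> with \<open>m = A / (A + p)\<close>, while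
  positivity of \<open>\<alpha>\<close> gives \<open>k < m + g\<close>, and \<open>g < 1 - m\<close> because \<open>p - 1 < p\<close>. In particular \<open>k\<close> and \<open>g\<close>
  are less than \<open>1\<close>. What has to be shown is that \<open>0\<close> is a stable and globally attracting
  equilibrium of the equation for \<open>e\<close>. Two mechanisms are at work, according to the sign of \<open>k - g\<close>.

  If \<open>g \<le> k\<close>, the map contracts the distance to the equilibrium, provided that \<open>1 + e\<close>
  is compared with \<open>1\<close> by ratio rather than by difference: if three consecutive values of \<open>1 + e\<close> lie in
  \<open>[1 / (1 + R), 1 + R]\<close>, the next one lies in the same interval with \<open>c R\<close> in place of \<open>R\<close>, where
  \<open>c < 1\<close> is fixed (\<open>within_ratio_contraction\<close>). Three values are needed rather than two because
  the effect of the positive term \<open>k e\<^sub>n\<close> is estimated by substituting the recurrence once more.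

  If \<open>k < g\<close>, such a contraction cannot be expected: as \<open>g\<close> tends to \<open>1\<close> the equation tends to
  Lyness' equation \<open>\<tau>\<^sub>n\<^sub>+\<^sub>1 \<tau>\<^sub>n\<^sub>-\<^sub>1 = (1 - k) + k \<tau>\<^sub>n\<close> for \<open>\<tau> = 1 + e\<close>, which has a first integral with
  closed level curves. For \<open>g < 1\<close> that integral, \<open>lyness\<close>, changes along the orbit by a positive
  multiple of \<open>e\<^sub>n\<^sub>-\<^sub>1 (e\<^sub>n\<^sub>+\<^sub>1 - e\<^sub>n\<^sub>-\<^sub>1)\<close> (\<open>lyness_increment\<close>). This can be positive, but then the following
  step loses more than was gained (\<open>lyness_two_step_decrease\<close>). Hence the minimum of two consecutive
  values of the integral never increases along an orbit and drops strictly within two steps away from the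
  equilibrium; a compactness argument in the style of LaSalle gives convergence, and monotonicity
  gives stability.
\<close>

section \<open>The equation for relative deviations\<close>

definition deviation_orbit :: "real \<Rightarrow> real \<Rightarrow> real \<Rightarrow> (nat \<Rightarrow> real) \<Rightarrow> bool" where
  "deviation_orbit k g m e \<longleftrightarrow>
     (\<forall>n. m - 1 \<le> e n) \<and> (\<forall>n. e (n + 2) * (1 + e n) = k * e (n + 1) - g * e n)"

lemma deviation_orbit_gt:
  assumes "deviation_orbit k g m e" "0 < m"
  shows "-1 < e n"
proof -
  have "m - 1 \<le> e n" using assms unfolding deviation_orbit_def by blast
  then show ?thesis using assms by linarith
qed

section \<open>Contraction in ratio when \<open>g \<le> k\<close>\<close>

text \<open>
  For \<open>R \<ge> 0\<close> and \<open>e > -1\<close> this is \<open>1 / (1 + R) \<le> 1 + e \<le> 1 + R\<close>. The recurrence divides by \<open>1 + e\<close>, so a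
  negative \<open>e\<close> pushes the orbit further than a positive one of the same size; the asymmetric
  interval compensates for that.
\<close>

definition within_ratio :: "real \<Rightarrow> real \<Rightarrow> bool" where
  "within_ratio R e \<longleftrightarrow> e \<le> R \<and> - e \<le> R * (1 + e)"

lemma within_ratio_imp_abs_le:
  assumes "within_ratio R e" "e > -1" "0 \<le> R"
  shows "\<bar>e\<bar> \<le> R"
proof (cases "e \<ge> 0")
  case False
  then have "R * e \<le> 0" using assms by (simp add: mult_nonneg_nonpos)
  then show ?thesis using assms False unfolding within_ratio_def by (simp add: algebra_simps)
qed (use assms in \<open>auto simp: within_ratio_def\<close>)

lemma within_ratio_mono:
  assumes "within_ratio R e" "R \<le> R'" "e > -1"
  shows "within_ratio R' e"
  using assms mult_right_mono[of R R' "1 + e"] unfolding within_ratio_def by linarith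

lemma abs_le_imp_within_ratio:
  assumes "\<bar>e\<bar> \<le> r" "r \<le> 1/2"
  shows "within_ratio (2 * r) e"
proof -
  have "r * 1 \<le> r * (2 * (1 + e))" using assms by (intro mult_left_mono) auto
  then show ?thesis using assms unfolding within_ratio_def by (auto simp: algebra_simps)
qed

text \<open>
  A deficit \<open>q\<close> of \<open>1 + e\<close> below \<open>1\<close> is admissible for \<open>R\<close> when \<open>q \<le> R / (1 + R)\<close>. Reducing it by the
  factor \<open>c\<close> makes it admissible for \<open>c R\<close>, since \<open>c R / (1 + R) \<le> c R / (1 + c R)\<close>.
\<close>

lemma shrunk_lower_bound:
  fixes c q R y :: real
  assumes "- y \<le> c * q" "0 \<le> q" "q \<le> R * (1 - q)" "0 \<le> c" "c \<le> 1" "0 \<le> R"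
  shows "- y \<le> c * R * (1 + y)"
proof -
  have "c * (q * R) \<le> 1 * (q * R)" using assms by (intro mult_right_mono) auto
  then have "c * (q + c * (q * R)) \<le> c * R"
    using assms by (intro mult_left_mono) (auto simp: algebra_simps)
  moreover have "- y * (1 + c * R) \<le> c * q * (1 + c * R)"
    using assms by (intro mult_right_mono) auto
  ultimately show ?thesis by (simp add: algebra_simps)
qed

text \<open>
  Here \<open>p, x, z, y\<close> are consecutive deviations. The delicate case is \<open>x < 0 < z\<close> with \<open>g > 0\<close>: both terms of
  \<open>k z - g x\<close> push \<open>y\<close> up, and bounding them separately loses too much, as \<open>k + g\<close>
  may exceed \<open>1\<close>. But \<open>z > 0\<close> forces \<open>g p < k x < 0\<close>, so \<open>p\<close> is itself negative, and eliminating \<open>z\<close> shows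
  \<open>y \<le> - g p / (1 + p)\<close>; this is where \<open>g \<le> k\<close> enters. The case \<open>x < 0\<close>, \<open>g \<le> 0\<close> is the one in which the
  denominator \<open>1 + x\<close> has to be estimated by \<open>m\<close>.
\<close>

lemma upper_bound_step:
  fixes k g m c R p x z y :: real
  assumes k: "0 < k" "k < 1" and m: "0 < m" "m \<le> 1" and gk: "g \<le> k"
    and c: "k \<le> c" "g \<le> c" "k - g \<le> c * m" and R: "0 \<le> R"
    and lo: "m - 1 \<le> p" "m - 1 \<le> x"
    and b: "within_ratio R p" "within_ratio R x" "within_ratio R z"
    and z: "z * (1 + p) = k * x - g * p" and y: "y * (1 + x) = k * z - g * x"
  shows "y \<le> c * R"
proof (cases "y \<le> 0")
  case True
  moreover have "0 \<le> c * R" using c k R by simp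
  ultimately show ?thesis by linarith
next
  case False
  have px: "0 < 1 + p" "0 < 1 + x" using lo m by auto
  have ub: "x \<le> R" "z \<le> R" "- p \<le> R * (1 + p)" "- x \<le> R * (1 + x)"
    using b unfolding within_ratio_def by auto
  have kz: "k * z \<le> k * R" using ub k by (intro mult_left_mono) auto
  have kR: "k * R \<le> c * R" using c R by (intro mult_right_mono) auto
  have gR: "g * R \<le> c * R" using c R by (intro mult_right_mono) auto
  show ?thesis
  proof (cases "0 \<le> x")
    case True
    then have "y * 1 \<le> y * (1 + x)" using False by (intro mult_left_mono) auto
    then have "y \<le> k * z - g * x" using y by simp
    moreover have "k * z - g * x \<le> c * R"
    proof (cases "0 \<le> g")
      case True
      then have "0 \<le> g * x" using \<open>0 \<le> x\<close> by simp
      then show ?thesis using kz kR by linarith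
    next
      case False
      then have "- g * x \<le> - g * R" using ub by (intro mult_left_mono) auto
      moreover have "(k - g) * R \<le> c * R"
      proof (intro mult_right_mono)
        have "c * m \<le> c * 1" using m c k by (intro mult_left_mono) auto
        then show "k - g \<le> c" using c by linarith
      qed (use R in auto)
      ultimately show ?thesis using kz by (simp add: algebra_simps)
    qed
    ultimately show ?thesis by linarith
  next
    case xneg: False
    show ?thesis
    proof (cases "0 < g")
      case False
      then have "0 \<le> g * x" using xneg by (simp add: mult_nonpos_nonpos)
      then have "y * (1 + x) \<le> k * R" using y kz by linarith
      moreover have "y * m \<le> y * (1 + x)" using \<open>\<not> y \<le> 0\<close> lo by (intro mult_left_mono) auto
      moreover have "k * R \<le> c * m * R" using c R False by (intro mult_right_mono) auto
      ultimately have "y * m \<le> (c * R) * m" by (simp add: algebra_simps)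
      then show ?thesis using m by simp
    next
      case gpos: True
      show ?thesis
      proof (cases "z \<le> 0")
        case True
        then have "k * z \<le> 0" using k by (simp add: mult_nonneg_nonpos)
        moreover have "g * - x \<le> g * (R * (1 + x))" using ub gpos by (intro mult_left_mono) auto
        ultimately have "y * (1 + x) \<le> (g * R) * (1 + x)" using y by (simp add: algebra_simps)
        then show ?thesis using px gR by simp
      next
        case False
        then have "0 < z * (1 + p)" using px by simp
        then have kx: "g * p < k * x" using z by simp
        have "k * x < 0" using k xneg by (simp add: mult_pos_neg)
        then have gp: "g * p < 0" using kx by linarith
        \<comment> \<open>equivalent to \<open>y (1 + p) \<le> - g p\<close> once \<open>z\<close> has been eliminated\<close>
        have "x * (k\<^sup>2 - g) \<le> - (g * p) * (1 - k)"
        proof (cases "g \<le> k\<^sup>2")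
          case True
          have "x * (k\<^sup>2 - g) \<le> 0" using True xneg by (simp add: mult_nonpos_nonneg)
          moreover have "0 \<le> - (g * p) * (1 - k)"
            using gp k by (intro mult_nonneg_nonneg) auto
          ultimately show ?thesis by linarith
        next
          case False
          have "(- x * k) * (g - k\<^sup>2) \<le> (- (g * p)) * (g - k\<^sup>2)"
            using kx False by (intro mult_right_mono) (auto simp: algebra_simps)
          also have "\<dots> \<le> (- (g * p)) * (k * (1 - k))"
            using gp gk by (intro mult_left_mono) (auto simp: algebra_simps power2_eq_square)
          finally have "k * (x * (k\<^sup>2 - g)) \<le> k * (- (g * p) * (1 - k))" by (simp add: algebra_simps)
          then show ?thesis using k(1) by (rule mult_left_le_imp_le)
        qed
        then have "k * (k * x - g * p) - g * x * (1 + p) \<le> - g * p * (1 + x)"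
          by (simp add: algebra_simps power2_eq_square)
        then have "k * (z * (1 + p)) - g * x * (1 + p) \<le> - g * p * (1 + x)" using z by simp
        then have "(k * z - g * x) * (1 + p) \<le> (- g * p) * (1 + x)" by (simp add: algebra_simps)
        then have "(y * (1 + x)) * (1 + p) \<le> (- g * p) * (1 + x)" by (simp only: y)
        then have "(y * (1 + p)) * (1 + x) \<le> (- g * p) * (1 + x)" by (simp add: algebra_simps)
        then have "y * (1 + p) \<le> - g * p" using px(2) by (rule mult_right_le_imp_le)
        moreover have "g * - p \<le> g * (R * (1 + p))" using ub gpos by (intro mult_left_mono) auto
        ultimately have "y * (1 + p) \<le> (g * R) * (1 + p)" by (simp add: algebra_simps)
        then show ?thesis using px gR by simp
      qed
    qed
  qed
qed

text \<open>
  In each sign pattern a negative \<open>y\<close> satisfies \<open>- y \<le> c q\<close>, where \<open>q\<close> is a deficit admissible for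
  \<open>R\<close>: it is \<open>- z\<close> or \<open>max (- z) (- x)\<close>, or else \<open>t / (1 + t)\<close> with \<open>t = x\<close> or \<open>t = p\<close>. The last
  choice mirrors the delicate case of \<open>upper_bound_step\<close>: for \<open>z < 0 < x\<close> and \<open>g > 0\<close> one has \<open>0 < k x < g p\<close>, and
  eliminating \<open>z\<close> shows \<open>- y \<le> g p / (1 + p)\<close>.
\<close>

lemma lower_bound_step:
  fixes k g m c R p x z y :: real
  assumes k: "0 < k" "k < 1" and m: "0 < m" "m \<le> 1" and gk: "g \<le> k"
    and c: "k \<le> c" "g \<le> c" "k - g \<le> c * m" "c \<le> 1" and R: "0 \<le> R"
    and lo: "m - 1 \<le> p" "m - 1 \<le> x" "m - 1 \<le> z"
    and b: "within_ratio R p" "within_ratio R x" "within_ratio R z"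
    and z: "z * (1 + p) = k * x - g * p" and y: "y * (1 + x) = k * z - g * x"
  shows "- y \<le> c * R * (1 + y)"
proof -
  have px: "0 < 1 + p" "0 < 1 + x" using lo m by auto
  have ub: "p \<le> R" "x \<le> R" "- z \<le> R * (1 + z)" "- x \<le> R * (1 + x)"
    using b unfolding within_ratio_def by auto
  have "\<exists>q. 0 \<le> q \<and> q \<le> R * (1 - q) \<and> - y \<le> c * q"
  proof (cases "y \<ge> 0")
    case True
    then show ?thesis using R by (intro exI[of _ 0]) auto
  next
    case yneg: False
    show ?thesis
    proof (cases "x \<le> 0")
      case xneg: True
      show ?thesis
      proof (cases "0 < g \<and> - (k * z) \<le> g")
        case True
        have "z < 0"
        proof (rule ccontr)
          assume "\<not> z < 0"
          then have "0 \<le> k * z" using k by simp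
          moreover have "g * x \<le> 0" using True xneg by (simp add: mult_nonneg_nonpos)
          ultimately have "0 \<le> y * (1 + x)" using y by linarith
          then show False using yneg px by (simp add: zero_le_mult_iff)
        qed
        have "x * (g + k * z) \<le> 0" using xneg True by (simp add: mult_nonpos_nonneg)
        then have "- y * (1 + x) \<le> (k * - z) * (1 + x)" using y by (simp add: algebra_simps)
        then have "- y \<le> k * - z" using px by simp
        also have "\<dots> \<le> c * - z" using c \<open>z < 0\<close> by (intro mult_right_mono) auto
        finally show ?thesis using ub \<open>z < 0\<close> by (intro exI[of _ "- z"]) auto
      next
        case False
        define q where "q = max (- z) (- x)"
        have q: "0 \<le> q" "- z \<le> q" "- x \<le> q" "q \<le> 1 - m" "q \<le> R * (1 - q)"
          using xneg ub lo unfolding q_def by (auto simp: max_def)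
        \<comment> \<open>the quotient \<open>(k h - g h') / (1 - h')\<close> of deficits \<open>h = - z\<close> and \<open>h' = - x\<close> is largest when both
            equal \<open>q\<close>, and then \<open>1 - q \<ge> m\<close>\<close>
        have "(- (k * z) + g * x) * m \<le> ((k - g) * q) * (1 + x)"
        proof (cases "0 < g")
          case True
          then have kz: "g < k * - z" using False by auto
          have kq: "k * - z \<le> k * q" using q k by (intro mult_left_mono) auto
          have "0 \<le> (q + x) * (k * q - g)" using q kz kq by (intro mult_nonneg_nonneg) auto
          then have "(k * q + g * x) * (1 - q) \<le> ((k - g) * q) * (1 + x)"
            by (simp add: algebra_simps)
          moreover have "0 \<le> k * q + g * x"
          proof -
            have "g * - x \<le> k * q" using q gk True k xneg by (intro mult_mono) auto
            then show ?thesis by simp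
          qed
          then have "(k * q + g * x) * m \<le> (k * q + g * x) * (1 - q)"
            using q by (intro mult_left_mono) auto
          moreover have "(- (k * z) + g * x) * m \<le> (k * q + g * x) * m"
            using kq m by (intro mult_right_mono) auto
          ultimately show ?thesis by linarith
        next
          case False
          have "- (k * z) \<le> k * q" using q(2) k mult_left_mono[of "-z" q k] by auto
          moreover have "g * x \<le> - g * q" using q(3) False mult_left_mono[of "-x" q "-g"] by auto
          ultimately have "- (k * z) + g * x \<le> (k - g) * q" by (simp add: algebra_simps)
          then have "(- (k * z) + g * x) * m \<le> ((k - g) * q) * m" using m by (intro mult_right_mono) auto
          also have "\<dots> \<le> ((k - g) * q) * (1 + x)" using lo q gk by (intro mult_left_mono) auto
          finally show ?thesis .
        qed
        moreover have "- (k * z) + g * x = - y * (1 + x)" using y by simp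
        ultimately have "(- y * m) * (1 + x) \<le> ((k - g) * q) * (1 + x)"
          by (simp only: mult.commute mult.left_commute mult.assoc)
        then have "- y * m \<le> (k - g) * q" using px(2) by (rule mult_right_le_imp_le)
        also have "\<dots> \<le> (c * m) * q" using c q by (intro mult_right_mono) auto
        finally have "- y * m \<le> (c * q) * m" by (simp add: algebra_simps)
        then have "- y \<le> c * q" using m(1) by (rule mult_right_le_imp_le)
        then show ?thesis using q by blast
      qed
    next
      case xpos: False
      have frac: "0 \<le> t / (1 + t) \<and> t / (1 + t) \<le> R * (1 - t / (1 + t))" if "0 < t" "t \<le> R" for t
      proof -
        have "1 - t / (1 + t) = 1 / (1 + t)" using that by (simp add: field_simps)
        then show ?thesis using that by (simp add: divide_right_mono)
      qed
      show ?thesis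
      proof (cases "0 < g")
        case False
        then have "g * x \<le> 0" using xpos by (simp add: mult_nonpos_nonneg)
        moreover have "- y * 1 \<le> - y * (1 + x)" using yneg xpos by (intro mult_left_mono) auto
        ultimately have *: "- y \<le> k * - z" using y by simp
        then have "0 < k * - z" using yneg by linarith
        then have zn: "z < 0" using k by (simp add: mult_less_0_iff)
        have "k * - z \<le> c * - z" using c zn by (intro mult_right_mono) auto
        then have "- y \<le> c * - z" using * by linarith
        then show ?thesis using ub zn by (intro exI[of _ "- z"]) auto
      next
        case gpos: True
        show ?thesis
        proof (cases "0 \<le> z")
          case True
          then have "0 \<le> k * z" using k by simp
          then have "- y * (1 + x) \<le> g * x" using y by simp
          then have "- y \<le> g * (x / (1 + x))" using px by (simp add: field_simps)
          also have "\<dots> \<le> c * (x / (1 + x))" using c xpos by (intro mult_right_mono) auto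
          finally show ?thesis using frac[of x] xpos ub(2) by (intro exI[of _ "x / (1 + x)"]) auto
        next
          case False
          then have "z * (1 + p) < 0" using px by (simp add: mult_neg_pos)
          then have kx: "k * x < g * p" using z by simp
          have "0 < k * x" using k xpos by simp
          then have gp: "0 < g * p" using kx by linarith
          \<comment> \<open>equivalent to \<open>- g p \<le> y (1 + p)\<close> once \<open>z\<close> has been eliminated\<close>
          have "x * (g - k\<^sup>2) \<le> (g * p) * (1 - k)"
          proof (cases "g \<le> k\<^sup>2")
            case True
            have "x * (g - k\<^sup>2) \<le> 0" using True xpos by (simp add: mult_nonneg_nonpos)
            moreover have "0 \<le> (g * p) * (1 - k)" using gp k by simp
            ultimately show ?thesis by linarith
          next
            case False
            have "(k * x) * (g - k\<^sup>2) \<le> (g * p) * (g - k\<^sup>2)"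
              using kx False by (intro mult_right_mono) auto
            also have "\<dots> \<le> (g * p) * (k * (1 - k))"
              using gp gk by (intro mult_left_mono) (auto simp: algebra_simps power2_eq_square)
            finally have "k * (x * (g - k\<^sup>2)) \<le> k * ((g * p) * (1 - k))" by (simp add: algebra_simps)
            then show ?thesis using k by simp
          qed
          then have "- g * p * (1 + x) \<le> k * (k * x - g * p) - g * x * (1 + p)"
            by (simp add: algebra_simps power2_eq_square)
          then have "- g * p * (1 + x) \<le> k * (z * (1 + p)) - g * x * (1 + p)" using z by simp
          then have "(- g * p) * (1 + x) \<le> (k * z - g * x) * (1 + p)" by (simp add: algebra_simps)
          then have "(- g * p) * (1 + x) \<le> (y * (1 + x)) * (1 + p)" by (simp only: y)
          then have "(- g * p) * (1 + x) \<le> (y * (1 + p)) * (1 + x)" by (simp add: algebra_simps)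
          then have "- g * p \<le> y * (1 + p)" using px(2) by (rule mult_right_le_imp_le)
          then have *: "- y \<le> g * (p / (1 + p))" using px by (simp add: field_simps)
          have pp: "0 < p" using gp gpos by (simp add: zero_less_mult_iff)
          have "g * (p / (1 + p)) \<le> c * (p / (1 + p))" using c pp by (intro mult_right_mono) auto
          then have "- y \<le> c * (p / (1 + p))" using * by linarith
          then show ?thesis using frac[of p] pp ub(1) by (intro exI[of _ "p / (1 + p)"]) auto
        qed
      qed
    qed
  qed
  then obtain q where "0 \<le> q" "q \<le> R * (1 - q)" "- y \<le> c * q" by blast
  then show ?thesis using shrunk_lower_bound[of y c q R] c k R by simp
qed

lemma within_ratio_contraction:
  assumes orb: "deviation_orbit k g m e"
    and k: "0 < k" "k < 1" and m: "0 < m" "m \<le> 1" and gk: "g \<le> k"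
    and c: "k \<le> c" "g \<le> c" "k - g \<le> c * m" "c \<le> 1" and R: "0 \<le> R"
    and b: "within_ratio R (e n)" "within_ratio R (e (n + 1))" "within_ratio R (e (n + 2))"
  shows "within_ratio (c * R) (e (n + 3))"
proof -
  have lo: "m - 1 \<le> e n" "m - 1 \<le> e (n + 1)" "m - 1 \<le> e (n + 2)"
    using orb unfolding deviation_orbit_def by auto
  have z: "e (n + 2) * (1 + e n) = k * e (n + 1) - g * e n"
    using orb unfolding deviation_orbit_def by auto
  have "e ((n + 1) + 2) * (1 + e (n + 1)) = k * e ((n + 1) + 1) - g * e (n + 1)"
    using orb unfolding deviation_orbit_def by blast
  then have y: "e (n + 3) * (1 + e (n + 1)) = k * e (n + 2) - g * e (n + 1)"
    by (simp add: numeral_eq_Suc)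
  show ?thesis
    using upper_bound_step[OF k m gk c(1-3) R lo(1,2) b z y]
      lower_bound_step[OF k m gk c R lo b z y]
    unfolding within_ratio_def by simp
qed

lemma deviation_geometric_decay:
  assumes orb: "deviation_orbit k g m e"
    and k: "0 < k" "k < 1" and m: "0 < m" "m \<le> 1" and gk: "g \<le> k" "k < m + g"
  obtains c where "0 < c" "c < 1"
    "\<And>R n. \<lbrakk>0 \<le> R; within_ratio R (e 0); within_ratio R (e 1); within_ratio R (e 2)\<rbrakk>
      \<Longrightarrow> \<bar>e n\<bar> \<le> R * c ^ (n div 3)"
proof -
  define c where "c = max k (max g ((k - g) / m))"
  have "k - g < 1 * m" using gk by simp
  then have c1: "c < 1" using k m gk unfolding c_def by (simp add: pos_divide_less_eq)
  have c: "k \<le> c" "g \<le> c" "(k - g) / m \<le> c" unfolding c_def by auto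
  then have cm: "k - g \<le> c * m" using m by (simp add: pos_divide_le_eq)
  have c0: "0 < c" using c k by linarith
  have gt: "-1 < e n" for n using deviation_orbit_gt[OF orb] m by blast
  have "\<bar>e n\<bar> \<le> R * c ^ (n div 3)"
    if R: "0 \<le> R" and i: "within_ratio R (e 0)" "within_ratio R (e 1)" "within_ratio R (e 2)" for R n
  proof -
    \<comment> \<open>the contraction consumes three values at a time, so the radius shrinks once per block of three\<close>
    have block: "within_ratio (R * c ^ j) (e (3 * j)) \<and> within_ratio (R * c ^ j) (e (3 * j + 1))
      \<and> within_ratio (R * c ^ j) (e (3 * j + 2))" for j
    proof (induction j)
      case 0
      then show ?case using i by (simp add: numeral_2_eq_2)
    next
      case (Suc j)
      let ?R = "R * c ^ j"
      have R0: "0 \<le> ?R" using R c0 by simp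
      have cR: "c * ?R \<le> ?R" using R0 c1 by (simp add: mult_left_le_one_le c0 less_imp_le)
      note step = within_ratio_contraction[OF orb k m gk(1) c(1,2) cm less_imp_le[OF c1] R0]
      have w3: "within_ratio (c * ?R) (e (3 * j + 3))" using step[of "3 * j"] Suc by simp
      then have w3': "within_ratio ?R (e (3 * j + 3))" using within_ratio_mono cR gt by blast
      have w4: "within_ratio (c * ?R) (e (3 * j + 4))" using step[of "3 * j + 1"] Suc w3'
        by (simp add: numeral_eq_Suc)
      then have w4': "within_ratio ?R (e (3 * j + 4))" using within_ratio_mono cR gt by blast
      have w5: "within_ratio (c * ?R) (e (3 * j + 5))" using step[of "3 * j + 2"] Suc w3' w4'
        by (simp add: numeral_eq_Suc)
      show ?case using w3 w4 w5 by (simp add: numeral_eq_Suc algebra_simps)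
    qed
    define j i where "j = n div 3" and "i = n mod 3"
    have "i < 3" "n = 3 * j + i" unfolding i_def j_def by simp_all
    then have "n = 3 * j \<or> n = 3 * j + 1 \<or> n = 3 * j + 2" by linarith
    then have "within_ratio (R * c ^ j) (e n)" using block[of j] by (elim disjE; simp)
    then have "within_ratio (R * c ^ (n div 3)) (e n)" unfolding j_def .
    then show ?thesis using within_ratio_imp_abs_le gt R c0 by simp
  qed
  then show ?thesis using that c0 c1 by blast
qed

lemma deviation_tendsto_0_contractive:
  assumes orb: "deviation_orbit k g m e"
    and k: "0 < k" "k < 1" and m: "0 < m" "m \<le> 1" and gk: "g \<le> k" "k < m + g"
  shows "e \<longlonglongrightarrow> 0"
proof -
  obtain c where c: "0 < c" "c < 1"
    and decay: "\<And>R n. \<lbrakk>0 \<le> R; within_ratio R (e 0); within_ratio R (e 1); within_ratio R (e 2)\<rbrakk>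
      \<Longrightarrow> \<bar>e n\<bar> \<le> R * c ^ (n div 3)"
    using deviation_geometric_decay[OF assms] by metis
  have lo: "m - 1 \<le> e n" for n using orb unfolding deviation_orbit_def by auto
  \<comment> \<open>dividing by \<open>m\<close>, a lower bound for \<open>1 + e\<close>, turns a bound on \<open>\<bar>e\<bar>\<close> into one in ratio\<close>
  define R where "R = max \<bar>e 0\<bar> (max \<bar>e 1\<bar> \<bar>e 2\<bar>) / m"
  have R: "0 \<le> R" unfolding R_def using m by auto
  have w: "within_ratio R (e i)" if "\<bar>e i\<bar> \<le> R * m" for i
  proof -
    have "R * m \<le> R * 1" "R * m \<le> R * (1 + e i)"
      using R m lo[of i] by (intro mult_left_mono; simp)+
    then show ?thesis using that unfolding within_ratio_def by auto
  qed
  have "R * m = max \<bar>e 0\<bar> (max \<bar>e 1\<bar> \<bar>e 2\<bar>)" unfolding R_def using m by simp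
  then have "\<bar>e 0\<bar> \<le> R * m" "\<bar>e 1\<bar> \<le> R * m" "\<bar>e 2\<bar> \<le> R * m"
    by (simp_all add: le_max_iff_disj)
  then have "within_ratio R (e 0)" "within_ratio R (e 1)" "within_ratio R (e 2)"
    using w by blast+
  then have bound: "\<bar>e n\<bar> \<le> R * c ^ (n div 3)" for n using decay R by blast
  have "filterlim (\<lambda>n::nat. n div 3) at_top at_top"
    by (rule filterlim_at_top_div_const_nat) simp
  then have "(\<lambda>n. c ^ (n div 3)) \<longlonglongrightarrow> 0"
    using filterlim_compose[OF LIMSEQ_realpow_zero[of c]] c by simp
  then have "(\<lambda>n. R * c ^ (n div 3)) \<longlonglongrightarrow> 0" by (rule tendsto_mult_right_zero)
  then show ?thesis using bound by (intro Lim_null_comparison[of e]) auto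
qed

text \<open>
  The decay estimate starts from three values, whereas the smallness assumption concerns two; the third
  is at most \<open>2 \<delta>\<close> because \<open>1 + e\<^sub>0 \<ge> 1/2\<close>, and passing to a bound in ratio costs another factor \<open>2\<close>.
\<close>

lemma deviation_stable_contractive:
  assumes k: "0 < k" "k < 1" and m: "0 < m" "m \<le> 1" and gk: "g \<le> k" "k < m + g"
    and eps: "0 < \<epsilon>"
  obtains \<delta> where "0 < \<delta>"
    "\<And>e n. \<lbrakk>deviation_orbit k g m e; \<bar>e 0\<bar> + \<bar>e 1\<bar> < \<delta>\<rbrakk> \<Longrightarrow> \<bar>e n\<bar> < \<epsilon>"
proof -
  define \<delta> where "\<delta> = min (1/4) (\<epsilon> / 8)"
  have d: "0 < \<delta>" "\<delta> \<le> 1/4" "8 * \<delta> \<le> \<epsilon>" using eps unfolding \<delta>_def by auto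
  have "\<bar>e n\<bar> < \<epsilon>" if orb: "deviation_orbit k g m e" and s: "\<bar>e 0\<bar> + \<bar>e 1\<bar> < \<delta>" for e n
  proof -
    obtain c where c: "0 < c" "c < 1"
      and decay: "\<And>R n. \<lbrakk>0 \<le> R; within_ratio R (e 0); within_ratio R (e 1); within_ratio R (e 2)\<rbrakk>
        \<Longrightarrow> \<bar>e n\<bar> \<le> R * c ^ (n div 3)"
      using deviation_geometric_decay[OF orb k m gk] by metis
    have e2: "e 2 * (1 + e 0) = k * e 1 - g * e 0"
      using orb unfolding deviation_orbit_def by (metis add_0)
    have "\<bar>e 2\<bar> * (1/2) \<le> \<bar>e 2\<bar> * \<bar>1 + e 0\<bar>" using s d by (intro mult_left_mono) auto
    also have "\<dots> = \<bar>k * e 1 - g * e 0\<bar>" using e2 by (simp flip: abs_mult)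
    also have "\<dots> \<le> k * \<bar>e 1\<bar> + \<bar>g\<bar> * \<bar>e 0\<bar>"
      using abs_triangle_ineq4[of "k * e 1" "g * e 0"] k by (simp add: abs_mult)
    also have "\<dots> \<le> 1 * \<bar>e 1\<bar> + 1 * \<bar>e 0\<bar>" using k gk m by (intro add_mono mult_right_mono) auto
    finally have "\<bar>e 2\<bar> \<le> 2 * \<delta>" using s by simp
    then have "within_ratio (2 * (2 * \<delta>)) (e i)" if "i \<in> {0, 1, 2}" for i
      using that s d by (intro abs_le_imp_within_ratio) auto
    then have "\<bar>e n\<bar> \<le> 4 * \<delta> * c ^ (n div 3)" using decay[of "4 * \<delta>" n] d by simp
    also have "\<dots> \<le> 4 * \<delta> * 1" using c d by (intro mult_left_mono power_le_one) auto
    also have "\<dots> < \<epsilon>" using d by linarith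
    finally show ?thesis .
  qed
  then show ?thesis using that d by blast
qed

section \<open>Dissipation of Lyness' integral when \<open>k < g\<close>\<close>

text \<open>
  With \<open>\<sigma> = 1 + x\<close> and \<open>\<tau> = 1 + z\<close>, the first integral of \<open>\<tau>\<^sub>n\<^sub>+\<^sub>1 \<tau>\<^sub>n\<^sub>-\<^sub>1 = (1 - k) + k \<tau>\<^sub>n\<close> is
  \<open>(k + \<sigma>) (k + \<tau>) (1 - k + k \<sigma> + k \<tau>) / (\<sigma> \<tau>)\<close>. Subtracting its minimum \<open>(1 + k)\<^sup>3\<close>, attained at \<open>\<sigma> = \<tau> = 1\<close>,
  and dividing by \<open>k\<close> leaves the expression below, which vanishes at the equilibrium and from which
  positivity can be read off.
\<close>

definition lyness :: "real \<Rightarrow> real \<Rightarrow> real \<Rightarrow> real" where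
  "lyness k x z = x\<^sup>2 / (1 + x) + z\<^sup>2 / (1 + z)
     + k * ((x - z)\<^sup>2 + (1 - k) * (x * z)) / ((1 + x) * (1 + z))"

text \<open>
  The mixed term is nonnegative because \<open>(x - z)\<^sup>2 \<ge> - 4 x z\<close>. So a bound on the integral confines both arguments to
  a compact subset of \<open>]-1, \<infinity>[\<close>, and a small value forces both to be small.
\<close>

lemma lyness_ge:
  assumes "0 < k" "k < 1" "x > -1" "z > -1"
  shows "x\<^sup>2 / (1 + x) + z\<^sup>2 / (1 + z) \<le> lyness k x z"
proof -
  have "0 \<le> (x - z)\<^sup>2 + (1 - k) * (x * z)"
  proof (cases "0 \<le> x * z")
    case False
    then have "1 * (x * z) \<le> (1 - k) * (x * z)" using assms by (intro mult_right_mono_neg) auto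
    moreover have "0 \<le> (x - z)\<^sup>2 + 4 * (x * z)"
      using zero_le_power2[of "x + z"] by (simp add: power2_eq_square algebra_simps)
    ultimately show ?thesis using False by linarith
  qed (use assms in auto)
  then show ?thesis using assms unfolding lyness_def by auto
qed

text \<open>
  For \<open>g = 1\<close> the integral is conserved. In general \<open>y\<close> differs from the value prescribed by
  Lyness' equation by \<open>(1 - g) x / (1 + x)\<close>, and as a function of its last argument the integral takes equal values
  at that prescribed value and at \<open>x\<close>; this explains the factors \<open>x\<close> and \<open>y - x\<close>.
\<close>

lemma lyness_increment:
  assumes "x > -1" "z > -1" "y > -1" and y: "y * (1 + x) = k * z - g * x"
  shows "lyness k z y - lyness k x z
    = (1 - g) * (1 + k + z) * (x * (y - x)) / ((1 + x) * (1 + y) * (1 + z))"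
proof -
  have nz: "1 + x \<noteq> 0" "1 + z \<noteq> 0" "1 + y \<noteq> 0" using assms by auto
  \<comment> \<open>eliminating \<open>g\<close> leaves an identity of rational functions in \<open>x, y, z, k\<close>\<close>
  have g: "g * x = k * z - y * (1 + x)" using y by simp
  have "(1 - g) * (1 + k + z) * (x * (y - x)) = (1 + k + z) * (y - x) * (x - g * x)"
    by (simp add: algebra_simps)
  also have "\<dots> = (1 + k + z) * (y - x) * (x - k * z + y * (1 + x))"
    unfolding g by (simp add: algebra_simps)
  finally have *: "(1 - g) * (1 + k + z) * (x * (y - x)) = (1 + k + z) * (y - x) * (x - k * z + y * (1 + x))" .
  show ?thesis unfolding * unfolding lyness_def using nz
    by (simp add: divide_simps) algebra
qed

text \<open>
  The integral can fail to decrease at the first step only if \<open>x (y - x) \<ge> 0\<close>. For \<open>x > 0\<close> this means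
  \<open>0 < x \<le> y\<close>, and then \<open>k < g\<close> gives \<open>w < 0 < x \<le> y < z\<close>; for \<open>x < 0\<close> all inequalities are reversed. In both cases
  \<open>z (w - z)\<close> is negative and dominates \<open>x (y - x)\<close>, because \<open>z\<close> is the extreme value among \<open>x, y, z\<close> and \<open>w\<close> lies on
  the other side of \<open>0\<close>. For \<open>x = 0\<close> the first step conserves the integral and the second
  decreases it.
\<close>

lemma lyness_two_step_decrease:
  fixes k g x z y w :: real
  assumes k: "0 < k" "k < g" "g < 1"
    and lo: "x > -1" "z > -1" "y > -1" "w > -1"
    and y: "y * (1 + x) = k * z - g * x" and w: "w * (1 + z) = k * y - g * z"
    and nz: "x \<noteq> 0 \<or> z \<noteq> 0" and up: "lyness k x z \<le> lyness k z y"
  shows "lyness k y w < lyness k x z"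
proof -
  have pos: "0 < 1 + x" "0 < 1 + z" "0 < 1 + y" "0 < 1 + w" "0 < 1 + k + z" "0 < 1 + k + y"
    using lo k by auto
  have i1: "lyness k z y - lyness k x z
    = (1 - g) * (1 + k + z) * (x * (y - x)) / ((1 + x) * (1 + y) * (1 + z))"
    using lyness_increment[of x z y k g] lo y by auto
  have i2: "lyness k y w - lyness k z y
    = (1 - g) * (1 + k + y) * (z * (w - z)) / ((1 + z) * (1 + w) * (1 + y))"
    using lyness_increment[of z y w k g] lo w by auto
  have sum: "lyness k y w - lyness k x z = (1 - g) / ((1 + z) * (1 + y)) *
     ((1 + k + y) * (z * (w - z)) / (1 + w) + (1 + k + z) * (x * (y - x)) / (1 + x))"
    using i1 i2 pos by (simp add: divide_simps) algebra
  have "0 \<le> (1 - g) * (1 + k + z) * (x * (y - x)) / ((1 + x) * (1 + y) * (1 + z))"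
    using i1 up by linarith
  moreover have den: "0 < (1 + x) * (1 + y) * (1 + z)" using pos by simp
  ultimately have "0 \<le> (1 - g) * (1 + k + z) * (x * (y - x))"
    by (simp only: pos_le_divide_eq mult_zero_left)
  moreover have "0 < (1 - g) * (1 + k + z)" using pos k by simp
  ultimately have upxy: "0 \<le> x * (y - x)" by (metis mult_pos_neg not_le)
  have "(1 + k + y) * (z * (w - z)) / (1 + w) + (1 + k + z) * (x * (y - x)) / (1 + x) < 0"
  proof (cases x "0::real" rule: linorder_cases)
    case equal
    then have z0: "z \<noteq> 0" and yk: "y = k * z" using nz y by auto
    have "(1 + z) * (w - z) = z * (k\<^sup>2 - g - 1 - z)"
      using w yk by (simp add: algebra_simps power2_eq_square)
    then have "(1 + z) * (z * (w - z)) = z\<^sup>2 * (k\<^sup>2 - g - 1 - z)"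
      by (metis mult.left_commute mult.assoc power2_eq_square)
    moreover have "k\<^sup>2 - g - 1 - z < 0"
    proof -
      have "k * k \<le> k * 1" using k by (intro mult_left_mono) auto
      then show ?thesis using k lo unfolding power2_eq_square by linarith
    qed
    ultimately have "(1 + z) * (z * (w - z)) < 0" using z0 by (simp add: mult_pos_neg)
    then have "z * (w - z) < 0" using pos by (simp add: mult_less_0_iff)
    then have "(1 + k + y) * (z * (w - z)) / (1 + w) < 0" using pos by (simp add: divide_neg_pos mult_pos_neg)
    then show ?thesis using equal by simp
  next
    case greater
    then have yx: "x \<le> y" using upxy by (simp add: zero_le_mult_iff)
    have "y * 1 \<le> y * (1 + x)" using greater yx by (intro mult_left_mono) auto
    moreover have "0 < g * x" using greater k by simp
    ultimately have "y < k * z" using y by linarith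
    moreover from this have zp: "0 < z"
      using greater yx k by (metis less_le_trans less_trans mult_less_cancel_left_pos mult_zero_right)
    moreover have "k * z < 1 * z" using zp k by (intro mult_strict_right_mono) auto
    ultimately have yz: "y < z" by linarith
    have "k * y < g * z" using yz greater yx k by (intro mult_strict_mono) auto
    then have "w * (1 + z) < 0" using w by linarith
    then have wn: "w < 0" using pos by (simp add: mult_less_0_iff)
    have "0 \<le> (1 + k + z) * (x * (y - x))" using greater pos yx by simp
    then have "(1 + k + z) * (x * (y - x)) / (1 + x) \<le> (1 + k + z) * (x * (y - x)) / 1"
      using greater by (intro divide_left_mono) auto
    also have "\<dots> = (1 + k + z) * (x * (y - x))" by simp
    also have "\<dots> < (1 + k + y) * z\<^sup>2"
    proof -
      have "(1 + k) * (x * (y - x)) \<le> (1 + k) * (x * y)" using greater k by (intro mult_left_mono) auto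
      also have "\<dots> < (1 + k) * (z * z)"
        using greater yx yz k by (intro mult_strict_left_mono mult_strict_mono) auto
      finally have 1: "(1 + k) * (x * (y - x)) < (1 + k) * (z * z)" .
      have "z * (x * (y - x)) \<le> z * (z * y)" using greater yx yz zp by (intro mult_left_mono mult_mono) auto
      then show ?thesis using 1 by (simp add: algebra_simps power2_eq_square)
    qed
    also have "\<dots> \<le> - ((1 + k + y) * (z * (w - z)) / (1 + w))"
    proof -
      have "w * (z * z + z) \<le> 0" using wn zp by (intro mult_nonpos_nonneg) auto
      then have "z\<^sup>2 * (1 + w) \<le> z * (z - w)" by (simp add: algebra_simps power2_eq_square)
      then have "z\<^sup>2 \<le> z * (z - w) / (1 + w)" using pos by (simp add: pos_le_divide_eq)
      then have "(1 + k + y) * z\<^sup>2 \<le> (1 + k + y) * (z * (z - w) / (1 + w))"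
        using pos by (intro mult_left_mono) auto
      also have "\<dots> = - ((1 + k + y) * (z * (w - z)) / (1 + w))"
        using pos by (simp add: field_simps)
      finally show ?thesis .
    qed
    finally show ?thesis by simp
  next
    case less
    then have yx: "y \<le> x" using upxy by (simp add: zero_le_mult_iff)
    have "k * z \<le> x * (1 + x) + g * x"
      using mult_right_mono[OF yx, of "1 + x"] y pos by simp
    also have "\<dots> = (1 + x + g) * x" by (simp add: algebra_simps)
    also have "\<dots> < k * x" using less pos k by (intro mult_strict_right_mono_neg) auto
    finally have zx: "z < x" using k by simp
    have zn: "z < 0" using zx less by simp
    have kz: "k * z > -k" using mult_strict_left_mono[OF lo(2) k(1)] by simp
    have "(y - k * z) * (1 + x) = - x * (g + k * z)" using y by (simp add: algebra_simps)
    moreover have "0 < - x * (g + k * z)" using less kz k by (intro mult_pos_pos) auto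
    ultimately have "0 < (y - k * z) * (1 + x)" by simp
    then have ykz: "k * z < y" using pos by (simp add: zero_less_mult_iff)
    have "1 * z < k * z" using zn k by (intro mult_strict_right_mono_neg) auto
    then have zy: "z < y" using ykz by linarith
    have "g * z < k * z" using zn k by (intro mult_strict_right_mono_neg) auto
    also have "\<dots> < k * y" using zy k by simp
    finally have "0 < w * (1 + z)" using w by simp
    then have wp: "0 < w" using pos by (simp add: zero_less_mult_iff)
    have "(x - y) / (1 + x) \<le> (w - z) / (1 + w)"
    proof -
      have "(1 + z) * (1 + x) \<le> (1 + y) * (1 + w)" using zy less wp pos by (intro mult_mono) auto
      then have "(1 + z) / (1 + w) \<le> (1 + y) / (1 + x)" using pos by (simp add: divide_simps)
      moreover have "(x - y) / (1 + x) = 1 - (1 + y) / (1 + x)" "(w - z) / (1 + w) = 1 - (1 + z) / (1 + w)"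
        using pos by (simp_all add: divide_simps)
      ultimately show ?thesis by linarith
    qed
    have nn: "0 \<le> (x - y) / (1 + x)" "0 < (w - z) / (1 + w)" using yx pos wp zn by auto
    have "(1 + k + z) * - x < (1 + k + y) * - z" 
      using zx zy pos less by (intro mult_strict_mono) auto
    then have "((1 + k + z) * - x) * ((w - z) / (1 + w)) < ((1 + k + y) * - z) * ((w - z) / (1 + w))"
      using nn by (intro mult_strict_right_mono) auto
    moreover have "((1 + k + z) * - x) * ((x - y) / (1 + x)) \<le> ((1 + k + z) * - x) * ((w - z) / (1 + w))"
      using \<open>(x - y) / (1 + x) \<le> (w - z) / (1 + w)\<close> pos less by (intro mult_left_mono mult_nonneg_nonneg) auto
    ultimately have "((1 + k + z) * - x) * ((x - y) / (1 + x)) < ((1 + k + y) * - z) * ((w - z) / (1 + w))"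
      by linarith
    moreover have "((1 + k + z) * - x) * ((x - y) / (1 + x)) = (1 + k + z) * (x * (y - x)) / (1 + x)"
      "((1 + k + y) * - z) * ((w - z) / (1 + w)) = - ((1 + k + y) * (z * (w - z)) / (1 + w))"
      using pos by (simp_all add: field_simps)
    ultimately show ?thesis by linarith
  qed
  moreover have "0 < (1 - g) / ((1 + z) * (1 + y))" using k pos by simp
  ultimately have "lyness k y w - lyness k x z < 0" unfolding sum by (intro mult_pos_neg)
  then show ?thesis by simp
qed

text \<open>
  The integral may rise for a single step but is then lower two steps on, so this minimum behaves
  as a genuine Lyapunov function.
\<close>

definition lyness_min :: "real \<Rightarrow> (nat \<Rightarrow> real) \<Rightarrow> nat \<Rightarrow> real" where
  "lyness_min k e n = min (lyness k (e n) (e (n + 1))) (lyness k (e (n + 1)) (e (n + 2)))"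

lemma lyness_min_antimono:
  assumes orb: "deviation_orbit k g m e" and k: "0 < k" "k < g" "g < 1" and m: "0 < m"
  shows "lyness_min k e (Suc n) \<le> lyness_min k e n"
proof -
  have gt: "-1 < e i" for i using deviation_orbit_gt[OF orb] m by blast
  have rec: "e (i + 2) * (1 + e i) = k * e (i + 1) - g * e i" for i
    using orb unfolding deviation_orbit_def by auto
  show ?thesis
  proof (cases "e n = 0 \<and> e (n + 1) = 0 \<or> lyness k (e (n + 1)) (e (n + 2)) \<le> lyness k (e n) (e (n + 1))")
    case True
    moreover have "e (n + 2) = 0" if "e n = 0" "e (n + 1) = 0" using rec[of n] that by simp
    ultimately show ?thesis unfolding lyness_min_def by auto
  next
    case False
    then have "lyness k (e (n + 2)) (e (n + 3)) < lyness k (e n) (e (n + 1))"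
      using lyness_two_step_decrease[OF k, of "e n" "e (n + 1)" "e (n + 2)" "e (n + 3)"]
        gt rec[of n] rec[of "n + 1"] by (simp add: numeral_eq_Suc)
    then show ?thesis using False unfolding lyness_min_def by (simp add: numeral_eq_Suc)
  qed
qed

lemma lyness_min_strict:
  assumes orb: "deviation_orbit k g m e" and k: "0 < k" "k < g" "g < 1" and m: "0 < m"
    and nz: "e n \<noteq> 0"
  shows "lyness_min k e (n + 2) < lyness_min k e n"
proof -
  have gt: "-1 < e i" for i using deviation_orbit_gt[OF orb] m by blast
  have rec: "e (i + 2) * (1 + e i) = k * e (i + 1) - g * e i" for i
    using orb unfolding deviation_orbit_def by auto
  have dec: "lyness k (e (i + 2)) (e (i + 3)) < lyness k (e i) (e (i + 1))"
    if "e i \<noteq> 0 \<or> e (i + 1) \<noteq> 0" "lyness k (e i) (e (i + 1)) \<le> lyness k (e (i + 1)) (e (i + 2))" for i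
    using lyness_two_step_decrease[OF k, of "e i" "e (i + 1)" "e (i + 2)" "e (i + 3)"]
      gt rec[of i] rec[of "i + 1"] that by (simp add: numeral_eq_Suc)
  have nz': "e (n + 1) \<noteq> 0 \<or> e (n + 2) \<noteq> 0" using rec[of n] nz k by auto
  show ?thesis
  proof (cases "lyness k (e n) (e (n + 1)) \<le> lyness k (e (n + 1)) (e (n + 2))")
    case True
    then show ?thesis using dec[of n] nz unfolding lyness_min_def by (simp add: numeral_eq_Suc)
  next
    case False
    have "lyness k (e (n + 3)) (e (n + 4)) < lyness k (e (n + 1)) (e (n + 2))"
      if "lyness k (e (n + 1)) (e (n + 2)) \<le> lyness k (e (n + 2)) (e (n + 3))"
      using dec[of "n + 1"] nz' that by (simp add: numeral_eq_Suc)
    then have "min (lyness k (e (n + 2)) (e (n + 3))) (lyness k (e (n + 3)) (e (n + 4)))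
        < lyness k (e (n + 1)) (e (n + 2))" by linarith
    then show ?thesis using False unfolding lyness_min_def by (simp add: numeral_eq_Suc)
  qed
qed

text \<open>
  The middle deviation is an argument of both integrals in the minimum, so it is controlled whichever of
  them is the smaller.
\<close>

lemma lyness_min_controls_middle:
  assumes orb: "deviation_orbit k g m e" and k: "0 < k" "k < 1" and m: "0 < m"
  shows "(e (n + 1))\<^sup>2 / (1 + e (n + 1)) \<le> lyness_min k e n"
proof -
  have gt: "-1 < e i" for i using deviation_orbit_gt[OF orb] m by blast
  have "0 \<le> (e i)\<^sup>2 / (1 + e i)" for i using gt[of i] by simp
  from this[of n] this[of "n + 2"] show ?thesis
    using lyness_ge[OF k gt gt, of n "n + 1"] lyness_ge[OF k gt gt, of "n + 1" "n + 2"]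
    unfolding lyness_min_def by linarith
qed

text \<open>
  An orbit is bounded, so if it did not converge to \<open>0\<close> it would have, along a subsequence, a limit orbit that
  starts away from \<open>0\<close>. Along that limit orbit the Lyapunov function is constantly equal to its limit along
  the original orbit, which contradicts strict decrease.
\<close>

lemma deviation_tendsto_0_dissipative:
  assumes orb: "deviation_orbit k g m e" and k: "0 < k" "k < g" "g < 1" and m: "0 < m"
  shows "e \<longlonglongrightarrow> 0"
proof (rule ccontr)
  assume "\<not> e \<longlonglongrightarrow> 0"
  then obtain \<epsilon> where eps: "0 < \<epsilon>" and far: "\<And>N. \<exists>n\<ge>N. \<epsilon> \<le> \<bar>e n\<bar>"
    by (auto simp: LIMSEQ_iff not_less)
  have inf: "infinite {n. \<epsilon> \<le> \<bar>e n\<bar>}"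
    unfolding infinite_nat_iff_unbounded_le using far by blast
  obtain r :: "nat \<Rightarrow> nat" where r: "strict_mono r" "\<forall>n. \<epsilon> \<le> \<bar>e (r n)\<bar>"
    using infinite_enumerate[OF inf] by auto
  have k1: "k < 1" using k by simp
  have lo: "m - 1 \<le> e n" for n using orb unfolding deviation_orbit_def by auto
  have gt: "e n > -1" for n using lo[of n] m by simp
  have rec: "e (i + 2) * (1 + e i) = k * e (i + 1) - g * e i" for i
    using orb unfolding deviation_orbit_def by auto
  have anti: "antimono (lyness_min k e)" 
    using lyness_min_antimono[OF orb k m] by (rule decseq_SucI)
  define C where "C = lyness_min k e 0"
  have sq: "(e (n + 1))\<^sup>2 / (1 + e (n + 1)) \<le> C" for n
    using lyness_min_controls_middle[OF orb k(1) k1 m, of n] antimonoD[OF anti, of 0 n]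
    unfolding C_def by simp
  have up: "e (n + 1) \<le> C + 1" for n
  proof -
    have "(e (n + 1) - 1) * (1 + e (n + 1)) \<le> (e (n + 1))\<^sup>2" by (simp add: power2_eq_square algebra_simps)
    then have "e (n + 1) - 1 \<le> (e (n + 1))\<^sup>2 / (1 + e (n + 1))" using gt[of "n + 1"] by (simp add: pos_le_divide_eq)
    then show ?thesis using sq[of n] by simp
  qed
  have bd: "e n \<in> {m - 1..max (e 0) (C + 1)}" for n
    using lo[of n] up[of "n - 1"] by (cases n) auto
  have "range (\<lambda>n. (e (r n), e (r n + 1))) \<subseteq> {m - 1..max (e 0) (C + 1)} \<times> {m - 1..max (e 0) (C + 1)}"
    using bd by auto
  moreover have "bounded ({m - 1..max (e 0) (C + 1)} \<times> {m - 1..max (e 0) (C + 1)})"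
    by (intro bounded_Times compact_imp_bounded compact_Icc)
  ultimately have bounded: "bounded (range (\<lambda>n. (e (r n), e (r n + 1))))" by (rule bounded_subset[rotated])
  obtain l s where s: "strict_mono s"
    and lim: "((\<lambda>n. (e (r n), e (r n + 1))) \<circ> s) \<longlonglongrightarrow> l"
    using bounded_imp_convergent_subsequence[OF bounded] by blast
  define t where "t = r \<circ> s"
  have t: "strict_mono t" unfolding t_def using r s by (simp add: strict_mono_o)
  obtain x z where l: "l = (x, z)" by (cases l)
  have L0: "(\<lambda>n. e (t n)) \<longlonglongrightarrow> x" and L1: "(\<lambda>n. e (t n + 1)) \<longlonglongrightarrow> z"
    using tendsto_fst[OF lim] tendsto_snd[OF lim] by (simp_all add: l t_def o_def)
  \<comment> \<open>by the recurrence, every shift of the subsequence converges as well; the limits form an orbit\<close>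
  have conv: "\<exists>a. (\<lambda>n. e (t n + i)) \<longlonglongrightarrow> a" for i
  proof (induction i rule: less_induct)
    case (less i)
    show ?case
    proof (cases "i < 2")
      case True
      then have "i = 0 \<or> i = 1" by auto
      then show ?thesis using L0 L1 by auto
    next
      case False
      then obtain j where j: "i = j + 2" using le_Suc_ex[of 2 i] by (auto simp: not_less add.commute)
      obtain a b where a: "(\<lambda>n. e (t n + j)) \<longlonglongrightarrow> a" and b: "(\<lambda>n. e (t n + (j + 1))) \<longlonglongrightarrow> b"
        using less[of j] less[of "j + 1"] j by auto
      have "m - 1 \<le> a" using LIMSEQ_le_const[OF a] lo by blast
      then have "1 + a \<noteq> 0" using m by simp
      then have "(\<lambda>n. (k * e (t n + (j + 1)) - g * e (t n + j)) / (1 + e (t n + j)))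
        \<longlonglongrightarrow> (k * b - g * a) / (1 + a)" by (intro tendsto_intros a b)
      moreover have "(k * e (t n + (j + 1)) - g * e (t n + j)) / (1 + e (t n + j)) = e (t n + i)" for n
        using rec[of "t n + j"] gt[of "t n + j"] j by (simp add: nonzero_divide_eq_eq add.assoc)
      ultimately show ?thesis by auto
    qed
  qed
  then obtain f where f: "\<And>i. (\<lambda>n. e (t n + i)) \<longlonglongrightarrow> f i" by metis
  have flo: "m - 1 \<le> f i" for i using LIMSEQ_le_const[OF f] lo by blast
  have forb: "deviation_orbit k g m f"
    unfolding deviation_orbit_def
  proof (intro conjI allI flo)
    fix i
    have "(\<lambda>n. e (t n + (i + 2)) * (1 + e (t n + i))) \<longlonglongrightarrow> f (i + 2) * (1 + f i)"
      by (intro tendsto_intros f)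
    moreover have "(\<lambda>n. k * e (t n + (i + 1)) - g * e (t n + i)) \<longlonglongrightarrow> k * f (i + 1) - g * f i"
      by (intro tendsto_intros f)
    moreover have "e (t n + (i + 2)) * (1 + e (t n + i)) = k * e (t n + (i + 1)) - g * e (t n + i)" for n
      using rec[of "t n + i"] by (simp add: add.assoc)
    ultimately show "f (i + 2) * (1 + f i) = k * f (i + 1) - g * f i"
      by (simp add: LIMSEQ_unique)
  qed
  have fne: "1 + f i \<noteq> 0" for i using flo[of i] m by simp
  have Wlim: "(\<lambda>n. lyness_min k e (t n + i)) \<longlonglongrightarrow> lyness_min k f i" for i
    unfolding lyness_min_def lyness_def add.assoc
    by (intro tendsto_intros f) (use fne in auto)
  have "0 \<le> lyness_min k e n" for n
  proof -
    have "0 \<le> (e (n + 1))\<^sup>2 / (1 + e (n + 1))" using gt[of "n + 1"] by simp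
    then show ?thesis using lyness_min_controls_middle[OF orb k(1) k1 m, of n] by linarith
  qed
  then obtain \<omega> where om: "lyness_min k e \<longlonglongrightarrow> \<omega>"
    using decseq_convergent[OF anti, of 0] by blast
  have "lyness_min k f i = \<omega>" for i
  proof -
    have "strict_mono (\<lambda>n. t n + i)" using t by (simp add: strict_mono_def)
    then have "(\<lambda>n. lyness_min k e (t n + i)) \<longlonglongrightarrow> \<omega>"
      using LIMSEQ_subseq_LIMSEQ[OF om] by (simp add: o_def)
    then show ?thesis using LIMSEQ_unique[OF Wlim] by blast
  qed
  then have "lyness_min k f (0 + 2) = lyness_min k f 0" by metis
  then have "f 0 = 0" using lyness_min_strict[OF forb k m, of 0] by linarith
  moreover have "\<epsilon> \<le> \<bar>e (t n + 0)\<bar>" for n using r(2) by (simp add: t_def)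
  then have "\<epsilon> \<le> \<bar>f 0\<bar>" using LIMSEQ_le_const[OF tendsto_rabs[OF f[of 0]]] by blast
  ultimately show False using eps by simp
qed

lemma deviation_stable_dissipative:
  assumes k: "0 < k" "k < g" "g < 1" and m: "0 < m" and eps: "0 < \<epsilon>"
  obtains \<delta> where "0 < \<delta>"
    "\<And>e n. \<lbrakk>deviation_orbit k g m e; \<bar>e 0\<bar> + \<bar>e 1\<bar> < \<delta>\<rbrakk> \<Longrightarrow> \<bar>e n\<bar> < \<epsilon>"
proof -
  have k1: "k < 1" using k by simp
  \<comment> \<open>the integral is at most \<open>6 \<delta>\<^sup>2\<close> at the start, and \<open>e\<^sup>2 / (1 + e) < \<epsilon>\<^sup>2 / (1 + \<epsilon>)\<close> ensures \<open>\<bar>e\<bar> < \<epsilon>\<close>;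
      the choice of \<open>\<delta>\<close> makes the former smaller than the latter\<close>
  define \<delta> where "\<delta> = min (1/2) (\<epsilon> / (3 * (1 + \<epsilon>)))"
  have d: "0 < \<delta>" "\<delta> \<le> 1/2" "\<delta> \<le> \<epsilon> / (3 * (1 + \<epsilon>))" using eps unfolding \<delta>_def by auto
  have "\<epsilon> * 1 < \<epsilon> * (3 * (1 + \<epsilon>))" using eps by (intro mult_strict_left_mono) auto
  then have "\<epsilon> / (3 * (1 + \<epsilon>)) < \<epsilon>" using eps by (simp add: pos_divide_less_eq)
  then have "\<delta> < \<epsilon>" using d by linarith
  have "3 * (1 + \<epsilon>) * \<delta> \<le> \<epsilon>" using d(3) eps by (simp add: field_simps)
  then have "(3 * (1 + \<epsilon>) * \<delta>)\<^sup>2 \<le> \<epsilon>\<^sup>2" using d(1) eps by (intro power_mono) auto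
  then have "(1 + \<epsilon>) * (9 * (1 + \<epsilon>) * \<delta>\<^sup>2) \<le> \<epsilon>\<^sup>2" by (simp add: power2_eq_square algebra_simps)
  moreover have "(1 + \<epsilon>) * (6 * \<delta>\<^sup>2) < (1 + \<epsilon>) * (9 * (1 + \<epsilon>) * \<delta>\<^sup>2)"
    using d(1) eps by (intro mult_strict_left_mono mult_strict_right_mono) auto
  ultimately have small: "(1 + \<epsilon>) * (6 * \<delta>\<^sup>2) < \<epsilon>\<^sup>2" by linarith
  have "\<bar>e n\<bar> < \<epsilon>" if orb: "deviation_orbit k g m e" and s: "\<bar>e 0\<bar> + \<bar>e 1\<bar> < \<delta>" for e n
  proof (cases n)
    case 0
    then show ?thesis using s \<open>\<delta> < \<epsilon>\<close> by simp
  next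
    case (Suc j)
    have gt: "-1 < e i" for i using deviation_orbit_gt[OF orb] m by blast
    have anti: "antimono (lyness_min k e)" 
      using lyness_min_antimono[OF orb k m] by (rule decseq_SucI)
    define a b where "a = e 0" and "b = e 1"
    have ab: "\<bar>a\<bar> + \<bar>b\<bar> < \<delta>" "1/2 \<le> 1 + a" "1/2 \<le> 1 + b" using s d unfolding a_def b_def by auto
    have "(\<bar>a\<bar> + \<bar>b\<bar>)\<^sup>2 \<le> \<delta>\<^sup>2" using ab by (intro power_mono) auto
    moreover have "(a - b)\<^sup>2 + (1 - k) * (a * b) \<le> (\<bar>a\<bar> + \<bar>b\<bar>)\<^sup>2"
    proof -
      have "- (1 + k) * (a * b) \<le> 2 * \<bar>a * b\<bar>"
      proof -
        have "- (1 + k) * (a * b) \<le> \<bar>- (1 + k) * (a * b)\<bar>" by simp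
        also have "\<dots> = (1 + k) * \<bar>a * b\<bar>" using k by (simp add: abs_mult)
        also have "\<dots> \<le> 2 * \<bar>a * b\<bar>" using k1 by (intro mult_right_mono) auto
        finally show ?thesis .
      qed
      then show ?thesis by (simp add: power2_eq_square algebra_simps abs_mult)
    qed
    moreover have "a\<^sup>2 + b\<^sup>2 \<le> (\<bar>a\<bar> + \<bar>b\<bar>)\<^sup>2"
      by (simp add: power2_eq_square algebra_simps)
    ultimately have num: "(a - b)\<^sup>2 + (1 - k) * (a * b) \<le> \<delta>\<^sup>2" "a\<^sup>2 + b\<^sup>2 \<le> \<delta>\<^sup>2"
      by linarith+
    have den: "1/4 \<le> (1 + a) * (1 + b)" using mult_mono[OF ab(2,3)] ab by simp
    have 1: "a\<^sup>2 / (1 + a) \<le> 2 * a\<^sup>2" "b\<^sup>2 / (1 + b) \<le> 2 * b\<^sup>2"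
      using ab mult_left_mono[OF ab(2), of "2 * a\<^sup>2"] mult_left_mono[OF ab(3), of "2 * b\<^sup>2"]
      by (auto simp: pos_divide_le_eq)
    have 2: "k * ((a - b)\<^sup>2 + (1 - k) * (a * b)) / ((1 + a) * (1 + b)) \<le> 4 * \<delta>\<^sup>2"
    proof -
      have "k * ((a - b)\<^sup>2 + (1 - k) * (a * b)) \<le> k * \<delta>\<^sup>2" using num k by (intro mult_left_mono) auto
      also have "\<dots> \<le> 1 * \<delta>\<^sup>2" using k1 by (intro mult_right_mono) auto
      also have "\<dots> \<le> 4 * \<delta>\<^sup>2 * ((1 + a) * (1 + b))" using mult_left_mono[OF den, of "4 * \<delta>\<^sup>2"] by simp
      finally show ?thesis using den by (subst pos_divide_le_eq) auto
    qed
    have "lyness k a b \<le> 6 * \<delta>\<^sup>2" using 1 2 num(2) unfolding lyness_def by linarith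
    then have "lyness_min k e 0 \<le> 6 * \<delta>\<^sup>2" unfolding lyness_min_def a_def b_def by auto
    then have "(e n)\<^sup>2 / (1 + e n) \<le> 6 * \<delta>\<^sup>2"
      using lyness_min_controls_middle[OF orb k(1) k1 m, of j] antimonoD[OF anti, of 0 j] Suc by simp
    then have sq: "(e n)\<^sup>2 \<le> 6 * \<delta>\<^sup>2 * (1 + e n)" using gt[of n] by (simp add: pos_divide_le_eq)
    show ?thesis
    proof (rule ccontr)
      assume "\<not> \<bar>e n\<bar> < \<epsilon>"
      then have far: "\<epsilon> \<le> \<bar>e n\<bar>" by simp
      have "(1 + \<epsilon>) * (e n)\<^sup>2 \<le> (1 + \<epsilon>) * (6 * \<delta>\<^sup>2) * (1 + e n)"
        using mult_left_mono[OF sq, of "1 + \<epsilon>"] eps by (simp add: mult.assoc)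
      also have "\<dots> < \<epsilon>\<^sup>2 * (1 + e n)" using small gt[of n] by (intro mult_strict_right_mono) auto
      also have "\<dots> \<le> \<epsilon>\<^sup>2 * (1 + \<bar>e n\<bar>)" by (intro mult_left_mono) auto
      finally have "(1 + \<epsilon>) * \<bar>e n\<bar>\<^sup>2 < \<epsilon>\<^sup>2 * (1 + \<bar>e n\<bar>)" by simp
      moreover have "\<epsilon>\<^sup>2 \<le> \<bar>e n\<bar>\<^sup>2" using far eps by (intro power_mono) auto
      moreover have "\<epsilon> * \<bar>e n\<bar> * \<epsilon> \<le> \<epsilon> * \<bar>e n\<bar> * \<bar>e n\<bar>" using far eps by (intro mult_left_mono) auto
      ultimately show False by (simp add: power2_eq_square algebra_simps)
    qed
  qed
  then show ?thesis using that d by blast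
qed

section \<open>Stability and attraction of the zero deviation\<close>

lemma deviation_tendsto_0:
  assumes "deviation_orbit k g m e" "0 < k" "k < m + g" "0 < m" "m \<le> 1" "g < 1 - m"
  shows "e \<longlonglongrightarrow> 0"
proof (cases "g \<le> k")
  case True
  then show ?thesis using deviation_tendsto_0_contractive[of k g m e] assms by auto
next
  case False
  then show ?thesis using deviation_tendsto_0_dissipative[of k g m e] assms by auto
qed

lemma deviation_stable:
  assumes "0 < k" "k < m + g" "0 < m" "m \<le> 1" "g < 1 - m" "0 < \<epsilon>"
  obtains \<delta> where "0 < \<delta>"
    "\<And>e n. \<lbrakk>deviation_orbit k g m e; \<bar>e 0\<bar> + \<bar>e 1\<bar> < \<delta>\<rbrakk> \<Longrightarrow> \<bar>e n\<bar> < \<epsilon>"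
proof (cases "g \<le> k")
  case True
  then show ?thesis using deviation_stable_contractive[of k m g \<epsilon>] that assms by auto
next
  case False
  then show ?thesis using deviation_stable_dissipative[of k g m \<epsilon>] that assms by auto
qed

section \<open>Return to the original equation\<close>

lemma equilibrium_iff_quadratic:
  assumes "\<alpha> > 0" "A > 0"
  shows "equilibrium \<alpha> \<beta> A p \<longleftrightarrow> 0 < p \<and> p * (A + p) = \<alpha> + \<beta> * p + p"
proof -
  have "p \<noteq> 0" if "p * (A + p) = \<alpha> + \<beta> * p + p" using that assms by auto
  then show ?thesis using assms unfolding equilibrium_def rhs_def
    by (auto simp: eq_divide_eq le_less)
qed

lemma ex1_equilibrium:
  assumes "\<alpha> > 0" "A > 0"
  shows "\<exists>!p. equilibrium \<alpha> \<beta> A p"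
proof -
  define b where "b = \<beta> + 1 - A"
  have eq: "equilibrium \<alpha> \<beta> A p \<longleftrightarrow> 0 < p \<and> p * p = \<alpha> + b * p" for p
    unfolding equilibrium_iff_quadratic[OF assms] b_def by (auto simp: algebra_simps)
  define s where "s = sqrt (b\<^sup>2 + 4 * \<alpha>)"
  have "\<bar>b\<bar> < s" unfolding s_def using assms by (intro real_less_rsqrt) simp
  moreover have "s * s = b * b + 4 * \<alpha>" unfolding s_def using assms
    by (simp add: power2_eq_square)
  ultimately have "equilibrium \<alpha> \<beta> A ((b + s) / 2)"
    unfolding eq by (auto simp: field_simps)
  moreover have "p = q" if "equilibrium \<alpha> \<beta> A p" "equilibrium \<alpha> \<beta> A q" for p q
  proof -
    have p: "0 < p" "p * p = \<alpha> + b * p" and q: "0 < q" "q * q = \<alpha> + b * q" using that eq by auto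
    \<comment> \<open>two distinct roots of the quadratic would have the negative product \<open>- \<alpha>\<close>\<close>
    have "(p - q) * (p * q + \<alpha>) = q * (p * p) - p * (q * q) + p * \<alpha> - q * \<alpha>"
      by (simp add: algebra_simps)
    also have "\<dots> = 0" unfolding p(2) q(2) by (simp add: algebra_simps)
    finally have "p - q = 0 \<or> p * q + \<alpha> = 0" by simp
    moreover have "0 < p * q" using p q by simp
    ultimately show ?thesis using assms by auto
  qed
  ultimately show ?thesis by blast
qed

lemma nonneg_solution_nonneg:
  assumes "\<alpha> > 0" "\<beta> > 0" "A > 0" "nonneg_solution \<alpha> \<beta> A x"
  shows "0 \<le> x n"
proof -
  have "0 \<le> x n \<and> 0 \<le> x (n + 1)"
  proof (induction n)
    case (Suc n)
    have "x (n + 2) = (\<alpha> + \<beta> * x (n + 1) + x n) / (A + x n)"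
      using assms unfolding nonneg_solution_def rhs_def by blast
    then show ?case using Suc assms by auto
  qed (use assms in \<open>auto simp: nonneg_solution_def\<close>)
  then show ?thesis by simp
qed

lemma nonneg_solution_deviation_orbit:
  assumes pos: "\<alpha> > 0" "\<beta> > 0" "A > 0"
    and eq: "equilibrium \<alpha> \<beta> A p" and sol: "nonneg_solution \<alpha> \<beta> A x"
  shows "deviation_orbit (\<beta> / (A + p)) ((p - 1) / (A + p)) (A / (A + p)) (\<lambda>n. (x n - p) / (A + p))"
  unfolding deviation_orbit_def
proof (intro conjI allI)
  have p: "0 < p" "p * (A + p) = \<alpha> + \<beta> * p + p"
    using eq equilibrium_iff_quadratic pos by auto
  define D where "D = A + p"
  have D: "0 < D" using p pos unfolding D_def by simp
  fix n
  have x: "0 \<le> x n" using nonneg_solution_nonneg pos sol by blast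
  have "A / D - 1 = - p / D" using D unfolding D_def by (simp add: field_simps)
  also have "\<dots> \<le> (x n - p) / D" using x D by (intro divide_right_mono) auto
  finally show "A / (A + p) - 1 \<le> (x n - p) / (A + p)" unfolding D_def .
  have "x (n + 2) = (\<alpha> + \<beta> * x (n + 1) + x n) / (A + x n)"
    using sol unfolding nonneg_solution_def rhs_def by blast
  then have "x (n + 2) * (A + x n) = \<alpha> + \<beta> * x (n + 1) + x n" using x pos by simp
  then have "(x (n + 2) - p) * (A + x n) = \<beta> * (x (n + 1) - p) - (p - 1) * (x n - p)"
    using p(2) by (simp add: algebra_simps)
  moreover have "1 + (x n - p) / D = (A + x n) / D" using D unfolding D_def by (simp add: field_simps)
  ultimately show "(x (n + 2) - p) / (A + p) * (1 + (x n - p) / (A + p))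
      = \<beta> / (A + p) * ((x (n + 1) - p) / (A + p)) - (p - 1) / (A + p) * ((x n - p) / (A + p))"
    unfolding D_def[symmetric] using D by (simp flip: diff_divide_distrib)
qed

theorem theorem1:
  fixes \<alpha> \<beta> A :: real
  assumes "\<alpha> > 0" and "\<beta> > 0" and "A > 0"
  shows "(\<exists>!xbar. equilibrium \<alpha> \<beta> A xbar) \<and>
         (\<forall>xbar. equilibrium \<alpha> \<beta> A xbar \<longrightarrow> globally_asymptotically_stable \<alpha> \<beta> A xbar)"
proof (intro conjI allI impI)
  show "\<exists>!xbar. equilibrium \<alpha> \<beta> A xbar" using ex1_equilibrium assms by blast
next
  fix p assume eq: "equilibrium \<alpha> \<beta> A p"
  then have p: "0 < p" "p * (A + p) = \<alpha> + \<beta> * p + p"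
    using equilibrium_iff_quadratic assms by auto
  define D where "D = A + p"
  define k g m where "k = \<beta> / D" and "g = (p - 1) / D" and "m = A / D"
  have D: "0 < D" using p assms unfolding D_def by simp
  \<comment> \<open>the equilibrium equation reads \<open>p (D - \<beta> - 1) = \<alpha>\<close>, and its right-hand side is positive\<close>
  have "p * (\<beta> + 1) < p * D" using p assms unfolding D_def by (simp add: algebra_simps)
  then have "\<beta> + 1 < D" using p by simp
  then have "\<beta> / D < (A + (p - 1)) / D" "(p - 1) / D < p / D"
    using D by (intro divide_strict_right_mono; simp add: D_def)+
  moreover have "1 - m = p / D" using D unfolding m_def D_def by (simp add: field_simps)
  ultimately have par: "0 < k" "k < m + g" "0 < m" "m \<le> 1" "g < 1 - m"
    using assms D p unfolding k_def g_def m_def by (simp_all add: add_divide_distrib D_def)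
  have orb: "deviation_orbit k g m (\<lambda>n. (x n - p) / D)" if "nonneg_solution \<alpha> \<beta> A x" for x
    using nonneg_solution_deviation_orbit[OF assms eq that] unfolding k_def g_def m_def D_def .
  show "globally_asymptotically_stable \<alpha> \<beta> A p"
    unfolding globally_asymptotically_stable_def locally_stable_def
  proof (intro conjI allI impI)
    fix \<epsilon> :: real assume "0 < \<epsilon>"
    then have "0 < \<epsilon> / D" using D by simp
    then obtain \<delta> where d: "0 < \<delta>"
      and stable: "\<And>e n. \<lbrakk>deviation_orbit k g m e; \<bar>e 0\<bar> + \<bar>e 1\<bar> < \<delta>\<rbrakk> \<Longrightarrow> \<bar>e n\<bar> < \<epsilon> / D"
      using deviation_stable[OF par] by metis
    have "\<bar>x n - p\<bar> < \<epsilon>"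
      if sol: "nonneg_solution \<alpha> \<beta> A x" and near: "\<bar>x 0 - p\<bar> + \<bar>x 1 - p\<bar> < \<delta> * D" for x n
    proof -
      have "\<bar>(x 0 - p) / D\<bar> + \<bar>(x 1 - p) / D\<bar> = (\<bar>x 0 - p\<bar> + \<bar>x 1 - p\<bar>) / D"
        using D by (simp add: abs_divide add_divide_distrib)
      also have "\<dots> < \<delta>" using near D by (simp add: pos_divide_less_eq)
      finally have "\<bar>(x n - p) / D\<bar> < \<epsilon> / D" using stable[OF orb[OF sol]] by blast
      then show ?thesis using D by (simp add: abs_divide divide_less_cancel)
    qed
    then show "\<exists>\<delta>>0. \<forall>x. nonneg_solution \<alpha> \<beta> A x \<longrightarrow>
        \<bar>x 0 - p\<bar> + \<bar>x 1 - p\<bar> < \<delta> \<longrightarrow> (\<forall>n. \<bar>x n - p\<bar> < \<epsilon>)"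
      using d D by (intro exI[of _ "\<delta> * D"]) auto
  next
    fix x assume "nonneg_solution \<alpha> \<beta> A x"
    then have "(\<lambda>n. (x n - p) / D) \<longlonglongrightarrow> 0"
      using deviation_tendsto_0[OF orb] par by blast
    then have "(\<lambda>n. (x n - p) / D * D + p) \<longlonglongrightarrow> 0 * D + p" by (intro tendsto_intros)
    then show "x \<longlonglongrightarrow> p" using D by simp
  qed
qed

end
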